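(* For every integer $m\ge 5$, $$\gamma_{\mathrm{sdR}}(G_{2,m})=\begin{cases} m+1 & \text{if } m\equiv 1\pmod 4,\\ m & \text{otherwise}.\end{cases}$$
   Context: The $2\times m$ grid graph $G_{2,m}$ has vertex set $\{0,1\}\times\{0,\dots,m-1\}$, two vertices being adjacent iff their Euclidean distance is $1$. $N(u)$ is the open neighborhood, $N[u]=N(u)\cup\{u\}$; for $f:V\to\{-1,1,2,3\}$, $V_i=f^{-1}(i)$, $f(S)=\sum_{s\in S}f(s)$. A signed double Roman domination function (SDRDF) is $f:V\to\{-1,1,2,3\}$ with: (1) every $u\in V_{-1}$ has a neighbor in $V_3$ or at least two distinct neighbors in $V_2$; (2) every $u\in V_1$ has a neighbor in $V_2\cup V_3$; (3) $f(N[u])\ge1$ for all $u$. $\gamma_{\mathrm{sdR}}(G)$ is the minimum of $f(V)$ over all SDRDFs on $G$. *)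

theory Defs
  imports "HOL-Analysis.Product_Vector"
begin

text \<open>A graph is given by a vertex set \<open>V\<close> and an adjacency relation \<open>E\<close>.\<close>

definition nbhd :: "'a set \<Rightarrow> ('a \<Rightarrow> 'a \<Rightarrow> bool) \<Rightarrow> 'a \<Rightarrow> 'a set" where
  "nbhd V E u = {v \<in> V. E u v}"

definition closed_nbhd :: "'a set \<Rightarrow> ('a \<Rightarrow> 'a \<Rightarrow> bool) \<Rightarrow> 'a \<Rightarrow> 'a set" where
  "closed_nbhd V E u = insert u (nbhd V E u)"

text \<open>Only the values of \<open>f\<close> on \<open>V\<close> matter.\<close>

definition SDRDF :: "'a set \<Rightarrow> ('a \<Rightarrow> 'a \<Rightarrow> bool) \<Rightarrow> ('a \<Rightarrow> int) \<Rightarrow> bool" where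
  "SDRDF V E f \<longleftrightarrow>
     f ` V \<subseteq> {-1, 1, 2, 3} \<and>
     (\<forall>u\<in>V. f u = -1 \<longrightarrow>
        (\<exists>v\<in>nbhd V E u. f v = 3) \<or>
        (\<exists>v\<in>nbhd V E u. \<exists>w\<in>nbhd V E u. v \<noteq> w \<and> f v = 2 \<and> f w = 2)) \<and>
     (\<forall>u\<in>V. f u = 1 \<longrightarrow> (\<exists>v\<in>nbhd V E u. f v = 2 \<or> f v = 3)) \<and>
     (\<forall>u\<in>V. sum f (closed_nbhd V E u) \<ge> 1)"

definition gamma_sdR :: "'a set \<Rightarrow> ('a \<Rightarrow> 'a \<Rightarrow> bool) \<Rightarrow> int" where
  "gamma_sdR V E = Min {sum f V | f. SDRDF V E f}"

text \<open>On a finite graph the minimum is taken over a finite nonempty set, so that \<open>Min\<close> is meaningful.\<close>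

lemma SDRDF_weights_finite:
  assumes "finite V"
  shows "finite {sum f V | f. SDRDF V E f}"
proof (rule finite_subset)
  show "{sum f V | f. SDRDF V E f} \<subseteq> {- int (card V) .. 3 * int (card V)}"
  proof clarify
    fix f assume "SDRDF V E f"
    then have *: "f v \<in> {-1, 1, 2, 3}" if "v \<in> V" for v
      using that by (auto simp: SDRDF_def)
    have "-1 \<le> f v" "f v \<le> 3" if "v \<in> V" for v
      using *[OF that] by auto
    then show "sum f V \<in> {- int (card V) .. 3 * int (card V)}"
      using sum_bounded_below[of V "-1" f] sum_bounded_above[of V f 3] by (auto simp: mult.commute)
  qed
qed simp

lemma SDRDF_weights_nonempty:
  assumes "finite V"
  shows "{sum f V | f. SDRDF V E f} \<noteq> {}"
proof -
  have "finite (closed_nbhd V E u)" for u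
    using assms by (simp add: closed_nbhd_def nbhd_def)
  then have "card (closed_nbhd V E u) > 0" for u
    by (auto simp: card_gt_0_iff closed_nbhd_def)
  then have "SDRDF V E (\<lambda>_. 2)"
    by (auto simp: SDRDF_def Suc_le_eq intro: order_trans[of _ "2 * 1"])
  then show ?thesis by blast
qed

definition grid_verts :: "nat \<Rightarrow> (nat \<times> nat) set" where
  "grid_verts m = {0, 1} \<times> {0..<m}"

text \<open>On \<open>real \<times> real\<close> the library metric \<open>dist\<close> is the Euclidean distance, cf. \<open>dist_prod_def\<close>.\<close>

definition grid_adj :: "nat \<times> nat \<Rightarrow> nat \<times> nat \<Rightarrow> bool" where
  "grid_adj u v \<longleftrightarrow> dist (real (fst u), real (snd u)) (real (fst v), real (snd v)) = 1"

end

theory Submission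
  imports Defs
begin

text \<open>
  A labelling of the grid is read column by column. The conditions at a vertex are monotone in the
  labels of its neighbours, so all that a partial labelling imposes on the next column is a lower
  bound for each row. Hence the last column together with these two bounds is a sufficient state, and
  \<open>\<gamma>\<close> is a shortest path problem in a finite weighted graph: a table of minimal weights per state
  evolves by a tropical linear map, independent of the column. This iteration becomes periodic: the table
  after \<open>10\<close> columns is the table after \<open>6\<close> columns shifted by \<open>4\<close>. So the tables for
  at most ten columns, which are computed explicitly, give both bounds for every \<open>m\<close>.
\<close>

section \<open>Transitions between columns and the computed tables\<close>

text \<open>
  For a vertex with label \<open>x\<close>, vertical neighbour \<open>y\<close> and left neighbour \<open>l\<close>, the conditions at the
  vertex amount to this lower bound for the label of the right neighbour. A missing neighbour is given the label \<open>0\<close>,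
  which affects neither the sum nor the domination conditions. The value may exceed \<open>3\<close>; then
  no extension exists.
\<close>

definition need :: "int \<Rightarrow> int \<Rightarrow> int \<Rightarrow> int" where
  "need x y l = max (1 - x - y - l)
     (if x = -1 then
        (if y = 3 \<or> l = 3 \<or> y = 2 \<and> l = 2 then -1 else if y = 2 \<or> l = 2 then 2 else 3)
      else if x = 1 then (if y \<ge> 2 \<or> l \<ge> 2 then -1 else 2)
      else -1)"

type_synonym column = "int \<times> int"
type_synonym state = "(int \<times> int) \<times> (int \<times> int)"

text \<open>A state holds for each row the label in the last column and the lower bound for the next label.\<close>

fun state_of :: "column \<Rightarrow> column \<Rightarrow> state" where
  "state_of (a, b) (c, d) = ((c, need c d a), (d, need d c b))"

fun successor :: "state \<Rightarrow> column \<Rightarrow> state" where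
  "successor ((a, s), (b, t)) c = state_of (a, b) c"

fun admits :: "state \<Rightarrow> column \<Rightarrow> bool" where
  "admits ((a, s), (b, t)) (c, d) \<longleftrightarrow> s \<le> c \<and> t \<le> d"

fun weight :: "column \<Rightarrow> int" where
  "weight (a, b) = a + b"

definition columns :: "column list" where
  "columns = List.product [-1, 1, 2, 3] [-1, 1, 2, 3]"

lemma mem_columns_iff: "(a, b) \<in> set columns \<longleftrightarrow> a \<in> {-1, 1, 2, 3} \<and> b \<in> {-1, 1, 2, 3}"
  by (simp add: columns_def del: product.simps) auto

fun insert_min :: "'a \<Rightarrow> int \<Rightarrow> ('a \<times> int) list \<Rightarrow> ('a \<times> int) list" where
  "insert_min s v [] = [(s, v)]"
| "insert_min s v ((t, w) # L) = (if s = t then (t, min v w) # L else (t, w) # insert_min s v L)"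

fun prune :: "('a \<times> int) list \<Rightarrow> ('a \<times> int) list" where
  "prune [] = []"
| "prune ((s, v) # L) = insert_min s v (prune L)"

definition initial_table :: "(state \<times> int) list" where
  "initial_table = map (\<lambda>c. (state_of (0, 0) c, weight c)) columns"

definition extensions :: "(state \<times> int) list \<Rightarrow> (state \<times> int) list" where
  "extensions L = concat (map (\<lambda>(s, w). map (\<lambda>c. (successor s c, w + weight c)) (filter (admits s) columns)) L)"

definition step :: "(state \<times> int) list \<Rightarrow> (state \<times> int) list" where
  "step L = prune (extensions L)"

text \<open>The column \<open>(0, 0)\<close> stands for the missing column to the right of the grid;
  a state admitting it is one at which the labelling may end.\<close>

definition opt :: "(state \<times> int) list \<Rightarrow> int \<Rightarrow> bool" where
  "opt L v \<longleftrightarrow> list_ex (\<lambda>(s, w). admits s (0, 0) \<and> w = v) L \<and> list_all (\<lambda>(s, w). admits s (0, 0) \<longrightarrow> v \<le> w) L"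

definition same_shifted :: "int \<Rightarrow> ('a \<times> int) list \<Rightarrow> ('a \<times> int) list \<Rightarrow> bool" where
  "same_shifted k L L' \<longleftrightarrow> set (map (\<lambda>(s, w). (s, w + k)) L) = set L'"

text \<open>Table \<open>L i\<close> belongs to \<open>i + 1\<close> columns.\<close>

lemma tables:
  "let L4 = (step ^^ 4) initial_table; L5 = step L4; L6 = step L5; L7 = step L6; L8 = step L7
   in opt L4 6 \<and> opt L5 6 \<and> opt L6 7 \<and> opt L7 8 \<and> opt L8 10 \<and> same_shifted 4 L5 (step L8)"
  by code_simp

section \<open>Pruning a table to minimal weights\<close>

lemma insert_min_subset: "set (insert_min s v L) \<subseteq> insert (s, v) (set L)"
  by (induction s v L rule: insert_min.induct) (auto simp: min_def)

lemma insert_min_dominates: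
  assumes "(t, w) \<in> insert (s, v) (set L)"
  shows "\<exists>w'\<le>w. (t, w') \<in> set (insert_min s v L)"
  using assms
proof (induction s v L rule: insert_min.induct)
  case (2 s v r u L)
  show ?case
  proof (cases "s = r")
    case True
    show ?thesis
    proof (cases "t = s")
      case t: True
      show ?thesis
      proof (cases "w = v \<or> w = u")
        case True
        then show ?thesis using t \<open>s = r\<close> by (intro exI[of _ "min v u"]) auto
      next
        case False
        then show ?thesis using 2 t \<open>s = r\<close> by auto
      qed
    next
      case False
      then show ?thesis using 2 True by auto
    qed
  next
    case False
    then show ?thesis using 2 by auto
  qed
qed auto

lemma prune_subset: "set (prune L) \<subseteq> set L"
  by (induction L rule: prune.induct) (use insert_min_subset in fastforce)+

text \<open>Together with \<open>prune_subset\<close> this makes pruning harmless for both bounds: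
  no pair is invented, and a dropped one is matched or beaten by a pair with the same state.\<close>

lemma prune_dominates: "(s, w) \<in> set L \<Longrightarrow> \<exists>v\<le>w. (s, v) \<in> set (prune L)"
proof (induction L arbitrary: w rule: prune.induct)
  case (2 t u L)
  show ?case
  proof (cases "(s, w) = (t, u)")
    case True
    then show ?thesis using insert_min_dominates[of s w t u "prune L"] by simp
  next
    case False
    then obtain v where "v \<le> w" "(s, v) \<in> set (prune L)"
      using 2 by auto
    moreover from this obtain v' where "v' \<le> v" "(s, v') \<in> set (prune ((t, u) # L))"
      using insert_min_dominates[of s v t u "prune L"] by auto
    ultimately show ?thesis
      by (intro exI[of _ v']) simp
  qed
qed simp

section \<open>Partial labellings and the pairs they reach\<close>

text \<open>
  The labels of column \<open>i\<close> are \<open>g (Suc i)\<close>, and \<open>g 0\<close> is the missing column to the left of the grid;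
  a partial labelling with parameter \<open>n\<close> has \<open>n + 1\<close> columns, and the conditions at the last one are still open.
\<close>

definition partial :: "nat \<Rightarrow> (nat \<Rightarrow> column) \<Rightarrow> bool" where
  "partial n g \<longleftrightarrow> g 0 = (0, 0) \<and> (\<forall>i\<le>n. g (Suc i) \<in> set columns) \<and>
     (\<forall>i<n. admits (state_of (g i) (g (Suc i))) (g (Suc (Suc i))))"

text \<open>The transition without pruning, on sets, so that it applies both to the exact sets
  \<open>reach n\<close> and to the tables.\<close>

definition Step :: "(state \<times> int) set \<Rightarrow> (state \<times> int) set" where
  "Step X = {(successor s c, w + weight c) | s w c. (s, w) \<in> X \<and> c \<in> set columns \<and> admits s c}"

lemma StepI: "(s, w) \<in> X \<Longrightarrow> c \<in> set columns \<Longrightarrow> admits s c \<Longrightarrow> (successor s c, w + weight c) \<in> Step X"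
  unfolding Step_def by blast

lemma StepE:
  assumes "p \<in> Step X"
  obtains s w c where "p = (successor s c, w + weight c)" "(s, w) \<in> X" "c \<in> set columns" "admits s c"
  using assms unfolding Step_def by blast

lemma set_concat_map_filter:
  "set (concat (map (\<lambda>(s, w). map (f s w) (filter (P s) C)) L)) =
    {f s w c | s w c. (s, w) \<in> set L \<and> c \<in> set C \<and> P s c}"
  by fastforce

lemma set_extensions: "set (extensions L) = Step (set L)"
  unfolding extensions_def Step_def by (rule set_concat_map_filter)

definition reach :: "nat \<Rightarrow> (state \<times> int) set" where
  "reach n = {(state_of (g n) (g (Suc n)), \<Sum>i\<le>n. weight (g (Suc i))) | g. partial n g}"

lemma successor_state_of [simp]: "successor (state_of p q) c = state_of q c"
  by (cases p; cases q) simp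

lemma reach_0: "reach 0 = set initial_table"
proof (intro equalityI subsetI)
  fix p assume "p \<in> set initial_table"
  then obtain c where c: "c \<in> set columns" "p = (state_of (0, 0) c, weight c)"
    by (auto simp: initial_table_def)
  then show "p \<in> reach 0"
    by (auto simp: reach_def partial_def intro!: exI[of _ "\<lambda>i. if i = 0 then (0, 0) else c"])
qed (auto simp: reach_def partial_def initial_table_def)

text \<open>The state is sufficient: which columns may follow and which states result depend on the
  state alone, so any labelling that reaches it can be extended in the same way.\<close>

lemma reach_Suc: "reach (Suc n) = Step (reach n)"
proof (intro equalityI subsetI)
  fix p assume "p \<in> reach (Suc n)"
  then obtain g where g: "partial (Suc n) g"
    and p: "p = (state_of (g (Suc n)) (g (Suc (Suc n))), \<Sum>i\<le>Suc n. weight (g (Suc i)))"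
    by (auto simp: reach_def)
  have "partial n g"
    using g by (auto simp: partial_def)
  then have "(state_of (g n) (g (Suc n)), \<Sum>i\<le>n. weight (g (Suc i))) \<in> reach n"
    by (auto simp: reach_def)
  moreover have "g (Suc (Suc n)) \<in> set columns" "admits (state_of (g n) (g (Suc n))) (g (Suc (Suc n)))"
    using g by (auto simp: partial_def)
  ultimately show "p \<in> Step (reach n)"
    using StepI[of "state_of (g n) (g (Suc n))"] by (simp add: p)
next
  fix p assume "p \<in> Step (reach n)"
  then obtain g c where g: "partial n g" and c: "c \<in> set columns" "admits (state_of (g n) (g (Suc n))) c"
    and p: "p = (state_of (g (Suc n)) c, (\<Sum>i\<le>n. weight (g (Suc i))) + weight c)"
    by (auto simp: reach_def elim!: StepE)
  \<comment> \<open>\<open>partial n g\<close> and the weight sum read \<open>g\<close> only up to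
    \<open>Suc n\<close>, so the next entry can be overwritten freely.\<close>
  define h where "h = g(Suc (Suc n) := c)"
  have "partial (Suc n) h"
    using g c by (auto simp: partial_def h_def less_Suc_eq le_Suc_eq)
  moreover have "(\<Sum>i\<le>n. weight (h (Suc i))) = (\<Sum>i\<le>n. weight (g (Suc i)))"
    by (rule sum.cong) (auto simp: h_def)
  then have "p = (state_of (h (Suc n)) (h (Suc (Suc n))), \<Sum>i\<le>Suc n. weight (h (Suc i)))"
    by (simp add: p h_def)
  ultimately show "p \<in> reach (Suc n)"
    unfolding reach_def by blast
qed

section \<open>Tables as lower envelopes of the reachable pairs\<close>

definition represents :: "int \<Rightarrow> (state \<times> int) list \<Rightarrow> nat \<Rightarrow> bool" where
  "represents k L n \<longleftrightarrow> (\<forall>s v. (s, v) \<in> set L \<longrightarrow> (s, v + k) \<in> reach n) \<and>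
     (\<forall>s w. (s, w) \<in> reach n \<longrightarrow> (\<exists>v. v + k \<le> w \<and> (s, v) \<in> set L))"

lemma represents_initial: "represents 0 initial_table 0"
  by (auto simp: represents_def reach_0)

text \<open>Adding the weight of a column preserves comparisons between weights and commutes with
  the offset \<open>k\<close>.\<close>

lemma represents_step:
  assumes "represents k L n"
  shows "represents k (step L) (Suc n)"
  unfolding represents_def
proof (intro conjI allI impI)
  fix t v assume "(t, v) \<in> set (step L)"
  then have "(t, v) \<in> Step (set L)"
    using prune_subset[of "extensions L"] by (auto simp: step_def set_extensions)
  then obtain s w c where "(t, v) = (successor s c, w + weight c)"
    and "(s, w) \<in> set L" "c \<in> set columns" "admits s c"
    by (rule StepE)
  moreover from this have "(s, w + k) \<in> reach n"
    using assms unfolding represents_def by blast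
  ultimately show "(t, v + k) \<in> reach (Suc n)"
    using StepI[of s "w + k" "reach n" c] by (simp add: reach_Suc algebra_simps)
next
  fix t u assume "(t, u) \<in> reach (Suc n)"
  then have "(t, u) \<in> Step (reach n)"
    by (simp add: reach_Suc)
  then obtain s w c where tu: "(t, u) = (successor s c, w + weight c)"
    and *: "(s, w) \<in> reach n" "c \<in> set columns" "admits s c"
    by (rule StepE)
  obtain v where v: "v + k \<le> w" "(s, v) \<in> set L"
    using assms *(1) unfolding represents_def by blast
  then have "(successor s c, v + weight c) \<in> set (extensions L)"
    using * by (auto simp: set_extensions intro: StepI)
  then obtain v' where "v' \<le> v + weight c" "(successor s c, v') \<in> set (step L)"
    unfolding step_def using prune_dominates[of "successor s c" "v + weight c"] by blast
  then show "\<exists>v. v + k \<le> u \<and> (t, v) \<in> set (step L)"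
    using v tu by (intro exI[of _ v']) auto
qed

lemma same_shifted_mem:
  assumes "same_shifted d L L'"
  shows "(s, v) \<in> set L' \<longleftrightarrow> (s, v - d) \<in> set L"
proof -
  have "(s, v) \<in> set L' \<longleftrightarrow> (\<exists>t w. (t, w) \<in> set L \<and> s = t \<and> v = w + d)"
    using assms unfolding same_shifted_def by (force simp: set_eq_iff)
  then show ?thesis by (auto simp: algebra_simps intro: exI[of _ "v - d"])
qed

text \<open>The shift between two tables moves into the offset, so that finitely many tables serve
  every \<open>n\<close>.\<close>

lemma represents_shift:
  assumes "represents k L' n" "same_shifted d L L'"
  shows "represents (k + d) L n"
proof -
  note * = same_shifted_mem[OF assms(2)]
  show ?thesis
    unfolding represents_def
  proof (intro conjI allI impI)
    fix s v assume "(s, v) \<in> set L"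
    then have "(s, v + d) \<in> set L'" by (simp add: *)
    then have "(s, v + d + k) \<in> reach n"
      using assms(1) unfolding represents_def by blast
    then show "(s, v + (k + d)) \<in> reach n"
      by (simp add: algebra_simps)
  next
    fix s w assume "(s, w) \<in> reach n"
    then obtain v where "v + k \<le> w" "(s, v) \<in> set L'"
      using assms(1) unfolding represents_def by blast
    then show "\<exists>v. v + (k + d) \<le> w \<and> (s, v) \<in> set L"
      by (intro exI[of _ "v - d"]) (auto simp: *)
  qed
qed

section \<open>Optimal weights for every number of columns\<close>

definition optimum :: "nat \<Rightarrow> int \<Rightarrow> bool" where
  "optimum n v \<longleftrightarrow> (\<exists>s. admits s (0, 0) \<and> (s, v) \<in> reach n) \<and>
     (\<forall>s w. admits s (0, 0) \<longrightarrow> (s, w) \<in> reach n \<longrightarrow> v \<le> w)"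

lemma represents_optimum:
  assumes "represents k L n" "opt L v"
  shows "optimum n (v + k)"
proof -
  have L: "\<And>s v. (s, v) \<in> set L \<Longrightarrow> (s, v + k) \<in> reach n"
    "\<And>s w. (s, w) \<in> reach n \<Longrightarrow> \<exists>v. v + k \<le> w \<and> (s, v) \<in> set L"
    using assms(1) unfolding represents_def by blast+
  obtain s where "admits s (0, 0)" "(s, v) \<in> set L"
    using assms(2) by (auto simp: opt_def list_ex_iff simp del: admits.simps)
  moreover have "v \<le> w" if "admits s (0, 0)" "(s, w) \<in> set L" for s w
    using assms(2) that by (auto simp: opt_def list_all_iff simp del: admits.simps)
  ultimately show ?thesis
    unfolding optimum_def using L by (meson add_le_cancel_right order_trans)
qed

text \<open>Parameter \<open>n\<close> means \<open>n + 1\<close> columns, so the four parts treat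
  the residues 1, 2, 3, 0 of the number of columns modulo 4.\<close>

lemma optimum_periodic:
  "optimum (4 * k + 4) (4 * int k + 6)" (is ?A)
  "optimum (4 * k + 5) (4 * int k + 6)" (is ?B)
  "optimum (4 * k + 6) (4 * int k + 7)" (is ?C)
  "optimum (4 * k + 7) (4 * int k + 8)" (is ?D)
proof -
  define L where "L = (\<lambda>i. (step ^^ i) initial_table)"
  have L_Suc: "step (L i) = L (Suc i)" for i
    by (simp add: L_def)
  have opt: "opt (L 4) 6" "opt (L 5) 6" "opt (L 6) 7" "opt (L 7) 8" "opt (L 8) 10"
    and period: "same_shifted 4 (L 5) (L 9)"
    using tables by (simp_all add: L_def Let_def numeral_eq_Suc)
  have "represents 0 (L i) i" for i
    by (induction i) (auto simp: L_def represents_initial represents_step)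
  note rep = this
  \<comment> \<open>Here \<open>i\<close> stays arbitrary because the induction step uses the
    hypothesis at \<open>i = 4\<close>, where \<open>L 9\<close> turns back into \<open>L 5\<close>;
    the inner induction then regains all \<open>i\<close>.\<close>
  have rep4: "represents (4 * int k) (L (i + 5)) (4 * k + (i + 5))" for i k
  proof (induction k arbitrary: i)
    case 0
    then show ?case using rep by simp
  next
    case (Suc k)
    have "represents (4 * int k) (L 9) (4 * k + 9)"
      using Suc[of 4] by simp
    from represents_shift[OF this period] have base: "represents (4 * int (Suc k)) (L 5) (4 * Suc k + 5)"
      by (simp add: algebra_simps)
    show ?case
    proof (induction i)
      case 0
      then show ?case using base by simp
    next
      case (Suc i)
      then have "represents (4 * int (Suc k)) (step (L (i + 5))) (Suc (4 * Suc k + (i + 5)))"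
        by (rule represents_step)
      then show ?case by (simp add: L_Suc)
    qed
  qed
  show ?B ?C ?D
    using represents_optimum[OF rep4[of k 0]] represents_optimum[OF rep4[of k 1]]
      represents_optimum[OF rep4[of k 2]] opt by (simp_all add: add.commute)
  show ?A
  \<comment> \<open>\<open>L 4\<close> precedes the periodic range and serves only
    \<open>k = 0\<close>; otherwise \<open>4 * k + 4\<close> is \<open>4 * k' + 8\<close>, so
    \<open>L 8\<close> with optimum 10 is used.\<close>
  proof (cases k)
    case 0
    then show ?thesis using represents_optimum[OF rep[of 4]] opt by simp
  next
    case (Suc k')
    then show ?thesis
      using represents_optimum[OF rep4[of k' 3]] opt by (simp add: add.commute)
  qed
qed

section \<open>Euclidean adjacency and the local conditions on the grid\<close>

lemma sum_squares_eq_1_iff: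
  fixes p q :: int
  shows "p\<^sup>2 + q\<^sup>2 = 1 \<longleftrightarrow> p = 0 \<and> \<bar>q\<bar> = 1 \<or> \<bar>p\<bar> = 1 \<and> q = 0"
proof
  assume *: "p\<^sup>2 + q\<^sup>2 = 1"
  have "p\<^sup>2 \<le> 1\<^sup>2" "q\<^sup>2 \<le> 1\<^sup>2"
    using * zero_le_power2[of p] zero_le_power2[of q] unfolding one_power2 by linarith+
  then have "\<bar>p\<bar> \<le> 1" "\<bar>q\<bar> \<le> 1"
    by (simp_all only: abs_le_square_iff[symmetric] abs_one)
  then have "p \<in> {-1, 0, 1}" "q \<in> {-1, 0, 1}"
    by auto
  then show "p = 0 \<and> \<bar>q\<bar> = 1 \<or> \<bar>p\<bar> = 1 \<and> q = 0"
    using * by auto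
qed (auto simp: power2_eq_1_iff)

lemma grid_adj_iff:
  "grid_adj (a, b) (c, d) \<longleftrightarrow> a = c \<and> (b = Suc d \<or> d = Suc b) \<or> b = d \<and> (a = Suc c \<or> c = Suc a)"
proof -
  have "grid_adj (a, b) (c, d) \<longleftrightarrow> (real a - real c)\<^sup>2 + (real b - real d)\<^sup>2 = 1"
    by (simp add: grid_adj_def dist_prod_def dist_real_def)
  \<comment> \<open>Over the integers differences are not truncated, and the points of the unit
    circle can be listed.\<close>
  also have "\<dots> \<longleftrightarrow> real_of_int ((int a - int c)\<^sup>2 + (int b - int d)\<^sup>2) = real_of_int 1"
    by simp
  also have "\<dots> \<longleftrightarrow> (int a - int c)\<^sup>2 + (int b - int d)\<^sup>2 = 1"
    by (simp only: of_int_eq_iff)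
  finally show ?thesis
    by (auto simp: sum_squares_eq_1_iff)
qed

text \<open>With two rows, \<open>1 - r\<close> is the row other than \<open>r\<close>.\<close>

lemma nbhd_grid:
  assumes "r < 2" "i < m"
  shows "nbhd (grid_verts m) grid_adj (r, i) =
    {(1 - r, i)} \<union> (if i = 0 then {} else {(r, i - 1)}) \<union> (if Suc i < m then {(r, Suc i)} else {})"
  using assms by (auto simp: nbhd_def grid_verts_def grid_adj_iff split: if_splits)

text \<open>The neighbourhood is a parameter so that the explicit sets of \<open>nbhd_grid\<close>
  can take its place.\<close>

definition locally_valid :: "('a \<Rightarrow> int) \<Rightarrow> 'a \<Rightarrow> 'a set \<Rightarrow> bool" where
  "locally_valid f u N \<longleftrightarrow>
     (f u = -1 \<longrightarrow> (\<exists>v\<in>N. f v = 3) \<or> (\<exists>v\<in>N. \<exists>w\<in>N. v \<noteq> w \<and> f v = 2 \<and> f w = 2)) \<and>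
     (f u = 1 \<longrightarrow> (\<exists>v\<in>N. f v = 2 \<or> f v = 3)) \<and>
     sum f (insert u N) \<ge> 1"

lemma SDRDF_iff_locally_valid:
  "SDRDF V E f \<longleftrightarrow> f ` V \<subseteq> {-1, 1, 2, 3} \<and> (\<forall>u\<in>V. locally_valid f u (nbhd V E u))"
  unfolding SDRDF_def locally_valid_def closed_nbhd_def by blast

text \<open>A check of 400 cases that \<open>need\<close> encodes the conditions at a vertex. Only
  \<open>l\<close> and \<open>r\<close> may be \<open>0\<close>, since the vertical neighbour always
  exists.\<close>

lemma need_le_iff:
  assumes "x \<in> {-1, 1, 2, 3}" "y \<in> {-1, 1, 2, 3}" "l \<in> {-1, 0, 1, 2, 3}" "r \<in> {-1, 0, 1, 2, 3}"
  shows "need x y l \<le> r \<longleftrightarrow>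
    (x = -1 \<longrightarrow> y = 3 \<or> l = 3 \<or> r = 3 \<or> y = 2 \<and> l = 2 \<or> y = 2 \<and> r = 2 \<or> l = 2 \<and> r = 2) \<and>
    (x = 1 \<longrightarrow> y \<ge> 2 \<or> l \<ge> 2 \<or> r \<ge> 2) \<and> x + y + l + r \<ge> 1"
  using assms unfolding need_def insert_iff empty_iff by (elim disjE) simp_all

text \<open>The shift by one makes room for the missing column on the left, matching the indexing in
  \<open>partial\<close>.\<close>

definition padded :: "nat \<Rightarrow> (nat \<times> nat \<Rightarrow> int) \<Rightarrow> nat \<times> nat \<Rightarrow> int" where
  "padded m f = (\<lambda>(r, i). if 1 \<le> i \<and> i \<le> m then f (r, i - 1) else 0)"

lemma locally_valid_grid:
  assumes f: "f ` grid_verts m \<subseteq> {-1, 1, 2, 3}" and "r < 2" "i < m"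
  shows "locally_valid f (r, i) (nbhd (grid_verts m) grid_adj (r, i)) \<longleftrightarrow>
    need (padded m f (r, Suc i)) (padded m f (1 - r, Suc i)) (padded m f (r, i)) \<le> padded m f (r, Suc (Suc i))"
proof -
  have val: "f (s, j) \<in> {-1, 1, 2, 3}" if "s < 2" "j < m" for s j
  proof -
    have "(s, j) \<in> grid_verts m"
      using that by (auto simp: grid_verts_def)
    then show ?thesis using f by blast
  qed
  have pad: "padded m f (s, j) \<in> {-1, 0, 1, 2, 3}" if "s < 2" for s j
    using val[of s "j - 1"] that by (auto simp: padded_def)
  have *: "padded m f (r, Suc i) = f (r, i)" "padded m f (1 - r, Suc i) = f (1 - r, i)"
    "padded m f (r, i) = (if i = 0 then 0 else f (r, i - 1))"
    "padded m f (r, Suc (Suc i)) = (if Suc i < m then f (r, Suc i) else 0)"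
    using assms by (auto simp: padded_def)
  have ge2: "f (s, j) \<ge> 2 \<longleftrightarrow> f (s, j) = 2 \<or> f (s, j) = 3" if "s < 2" "j < m" for s j
    using val[OF that] by auto
  \<comment> \<open>The vertex and its neighbours are pairwise distinct, which matters for the sum
    over the closed neighbourhood and for two distinct neighbours labelled 2.\<close>
  have r: "1 - r < 2" "1 - r \<noteq> r" "r \<noteq> 1 - r"
    using \<open>r < 2\<close> by presburger+
  have i: "i - 1 < m" "i \<noteq> 0 \<Longrightarrow> i - 1 \<noteq> i" "i - 1 \<noteq> Suc i"
    using \<open>i < m\<close> by auto
  show ?thesis
    using need_le_iff[OF val[OF \<open>r < 2\<close> \<open>i < m\<close>] val[OF r(1) \<open>i < m\<close>] pad[OF \<open>r < 2\<close>, of i] pad[OF \<open>r < 2\<close>, of "Suc (Suc i)"]]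
      ge2[OF \<open>r < 2\<close>, of "i - 1"] ge2[OF \<open>r < 2\<close>, of "Suc i"] ge2[OF r(1) \<open>i < m\<close>] i
    unfolding nbhd_grid[OF \<open>r < 2\<close> \<open>i < m\<close>] * locally_valid_def
    \<comment> \<open>Fixing which of the left and right columns exist makes the neighbourhood an
      explicit set.\<close>
    by (cases "i = 0"; cases "Suc i < m"; use r in \<open>simp add: algebra_simps; blast\<close>)
qed

section \<open>SDRDFs as column sequences and the resulting minimum\<close>

definition padded_column :: "nat \<Rightarrow> (nat \<times> nat \<Rightarrow> int) \<Rightarrow> nat \<Rightarrow> column" where
  "padded_column m f i = (padded m f (0, i), padded m f (1, i))"

lemma SDRDF_grid_iff:
  "SDRDF (grid_verts (Suc n)) grid_adj f \<longleftrightarrow> partial n (padded_column (Suc n) f) \<and>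
     admits (state_of (padded_column (Suc n) f n) (padded_column (Suc n) f (Suc n))) (0, 0)"
proof -
  let ?m = "Suc n" and ?c = "padded_column (Suc n) f"
  have V: "(\<forall>u \<in> grid_verts ?m. P u) \<longleftrightarrow> (\<forall>i\<le>n. P (0, i) \<and> P (1, i))" for P
    by (auto simp: grid_verts_def)
  have c: "?c (Suc i) = (f (0, i), f (1, i))" if "i \<le> n" for i
    using that by (simp add: padded_column_def padded_def)
  have range: "f ` grid_verts ?m \<subseteq> {-1, 1, 2, 3} \<longleftrightarrow> (\<forall>i\<le>n. ?c (Suc i) \<in> set columns)"
    unfolding image_subset_iff V by (simp add: c mem_columns_iff del: insert_iff)
  have "SDRDF (grid_verts ?m) grid_adj f \<longleftrightarrow> (\<forall>i\<le>n. ?c (Suc i) \<in> set columns) \<and>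
    (\<forall>i\<le>n. admits (state_of (?c i) (?c (Suc i))) (?c (Suc (Suc i))))"
    unfolding SDRDF_iff_locally_valid V range[symmetric]
    using locally_valid_grid[of f ?m 0] locally_valid_grid[of f ?m 1]
    by (auto simp: padded_column_def simp flip: less_Suc_eq_le)
  \<comment> \<open>These are the missing columns at both ends: the condition for
    \<open>i = n\<close> becomes the closing one, and those for \<open>i < n\<close> belong to
    \<open>partial\<close>.\<close>
  moreover have "?c 0 = (0, 0)" "?c (Suc (Suc n)) = (0, 0)"
    by (simp_all add: padded_column_def padded_def)
  ultimately show ?thesis
    unfolding partial_def by (auto simp: le_less)
qed

lemma sum_grid:
  "sum f (grid_verts (Suc n)) = (\<Sum>i\<le>n. weight (padded_column (Suc n) f (Suc i)))"
proof -
  have "sum f (grid_verts (Suc n)) = (\<Sum>r\<in>{0, 1}. \<Sum>i\<le>n. f (r, i))"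
    unfolding grid_verts_def sum.cartesian_product
    by (simp add: atLeast0LessThan lessThan_Suc_atMost)
  also have "\<dots> = (\<Sum>i\<le>n. f (0, i) + f (1, i))"
    by (simp add: sum.distrib)
  also have "\<dots> = (\<Sum>i\<le>n. weight (padded_column (Suc n) f (Suc i)))"
    by (rule sum.cong) (simp_all add: padded_column_def padded_def)
  finally show ?thesis .
qed

lemma SDRDF_weights_grid:
  "{sum f (grid_verts (Suc n)) | f. SDRDF (grid_verts (Suc n)) grid_adj f} =
   {w. \<exists>s. admits s (0, 0) \<and> (s, w) \<in> reach n}" (is "?A = ?B")
proof (intro equalityI subsetI)
  fix w assume "w \<in> ?A"
  then show "w \<in> ?B"
    unfolding SDRDF_grid_iff sum_grid reach_def by blast
next
  fix w assume "w \<in> ?B"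
  then obtain g where g: "partial n g" "admits (state_of (g n) (g (Suc n))) (0, 0)"
    and w: "w = (\<Sum>i\<le>n. weight (g (Suc i)))"
    by (auto simp: reach_def simp del: admits.simps)
  define f where "f = (\<lambda>(r :: nat, i). if r = 0 then fst (g (Suc i)) else snd (g (Suc i)))"
  \<comment> \<open>Beyond \<open>Suc n\<close> the sequence \<open>g\<close> is arbitrary while the
    padded columns are \<open>(0, 0)\<close>, hence the bound on \<open>i\<close>.\<close>
  have c: "padded_column (Suc n) f i = g i" if "i \<le> Suc n" for i
    using that g(1) by (cases i) (auto simp: padded_column_def padded_def f_def partial_def)
  have "partial n (padded_column (Suc n) f)"
    using g(1) by (simp add: partial_def c)
  then have "SDRDF (grid_verts (Suc n)) grid_adj f"
    using g(2) by (simp add: SDRDF_grid_iff c)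
  moreover have "sum f (grid_verts (Suc n)) = w"
    by (simp add: sum_grid w c)
  ultimately show "w \<in> ?A" by blast
qed

lemma gamma_sdR_grid:
  assumes "optimum n v"
  shows "gamma_sdR (grid_verts (Suc n)) grid_adj = v"
  unfolding gamma_sdR_def
proof (rule Min_eqI)
  show "finite {sum f (grid_verts (Suc n)) | f. SDRDF (grid_verts (Suc n)) grid_adj f}"
    by (rule SDRDF_weights_finite) (simp add: grid_verts_def)
qed (use assms in \<open>auto simp: SDRDF_weights_grid optimum_def simp del: admits.simps\<close>)

theorem theorem7:
  fixes m :: nat
  assumes "m \<ge> 5"
  shows "gamma_sdR (grid_verts m) grid_adj = (if m mod 4 = 1 then int m + 1 else int m)"
proof -
  \<comment> \<open>At \<open>k = 0\<close> the four parts of \<open>optimum_periodic\<close>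
    concern 5, 6, 7 and 8 columns, whence the offset 5.\<close>
  define k where "k = (m - 5) div 4"
  have "m = 4 * k + 5 \<or> m = 4 * k + 6 \<or> m = 4 * k + 7 \<or> m = 4 * k + 8"
    using assms unfolding k_def by presburger
  then show ?thesis
  proof (elim disjE)
    assume m: "m = 4 * k + 5"
    moreover from this have "m mod 4 = 1" by presburger
    ultimately show ?thesis
      using gamma_sdR_grid[OF optimum_periodic(1)[of k]] by (simp add: add.commute)
  next
    assume m: "m = 4 * k + 6"
    moreover from this have "m mod 4 \<noteq> 1" by presburger
    ultimately show ?thesis
      using gamma_sdR_grid[OF optimum_periodic(2)[of k]] by (simp add: add.commute)
  next
    assume m: "m = 4 * k + 7"
    moreover from this have "m mod 4 \<noteq> 1" by presburger
    ultimately show ?thesis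
      using gamma_sdR_grid[OF optimum_periodic(3)[of k]] by (simp add: add.commute)
  next
    assume m: "m = 4 * k + 8"
    moreover from this have "m mod 4 \<noteq> 1" by presburger
    ultimately show ?thesis
      using gamma_sdR_grid[OF optimum_periodic(4)[of k]] by (simp add: add.commute)
  qed
qed

end
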